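(* Let $n$ be a non-negative integer. Consider the overpartitions of $n$ such that: (i) if $1$ occurs as a part, then the first instance of $1$ is overlined; and (ii) for every positive integer $k$, if $k+1$ occurs as a part and $\overline{k}$ (the overlined $k$) occurs as a part, then the overlined part $\overline{k+1}$ occurs (that is, $(\overline{k+1},k+1,\dots,k+1,\overline{k})$ is allowed, but no pattern $(k+1,\overline{k})$ appears if the overlined $k+1$ is missing). The number of such overpartitions of $n$ is equal to the number of partitions of $n$ into parts of two colors, red and green, where the green parts are always congruent to $2$ modulo $3$ (and the red parts are arbitrary positive integers).
   Context: A partition of $n$ is a finite non-increasing sequence of positive integers (parts) with sum $n$. An overpartition of $n$ is a partition of $n$ in which the first appearance of each part size may (or may not) be overlined. In the two-color partitions, each part carries a color, red or green; parts may repeat, and only the multiplicity of each colored integer matters (red $k$ and green $k$ are different parts of the same size $k$). *)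

theory Defs
  imports Main "HOL-Library.Multiset"
begin

definition is_partition :: "nat list \<Rightarrow> nat \<Rightarrow> bool" where
  "is_partition xs n \<longleftrightarrow>
     sorted_wrt (\<ge>) xs \<and> (\<forall>x \<in> set xs. 0 < x) \<and> sum_list xs = n"

text \<open>A part of an overpartition is a pair of its size and a flag telling whether it is overlined.\<close>

type_synonym opart = "nat \<times> bool"

abbreviation plain :: "nat \<Rightarrow> opart" where
  "plain k \<equiv> (k, False)"

abbreviation overlined :: "nat \<Rightarrow> opart" where
  "overlined k \<equiv> (k, True)"

definition is_overpartition :: "opart list \<Rightarrow> nat \<Rightarrow> bool" where
  "is_overpartition ps n \<longleftrightarrow>
     is_partition (map fst ps) n \<and>
     (\<forall>i < length ps. snd (ps ! i) \<longrightarrow> (\<forall>j < i. fst (ps ! j) \<noteq> fst (ps ! i)))"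

definition overpartitions :: "nat \<Rightarrow> opart list set" where
  "overpartitions n = {ps. is_overpartition ps n}"

definition occurs :: "nat \<Rightarrow> opart list \<Rightarrow> bool" where
  "occurs k ps \<longleftrightarrow> plain k \<in> set ps \<or> overlined k \<in> set ps"

text \<open>In an overpartition only the first instance of a size can be overlined, so
  \<open>overlined 1 \<in> set ps\<close> says that the first instance of \<open>1\<close> is overlined.\<close>

definition admissible :: "opart list \<Rightarrow> bool" where
  "admissible ps \<longleftrightarrow>
     (occurs 1 ps \<longrightarrow> overlined 1 \<in> set ps) \<and>
     (\<forall>k > 0. occurs (k + 1) ps \<and> overlined k \<in> set ps \<longrightarrow> overlined (k + 1) \<in> set ps)"

datatype color = Red | Green

text \<open>Only the multiplicities of the coloured integers matter, hence multisets.\<close>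

definition two_color_partitions :: "nat \<Rightarrow> (color \<times> nat) multiset set" where
  "two_color_partitions n =
     {M. (\<forall>p \<in># M. 0 < snd p) \<and> sum_mset (image_mset snd M) = n}"

text \<open>Both counted sets are finite, so that cardinalities are meaningful.\<close>

lemma length_le_sum_list:
  fixes xs :: "nat list"
  assumes "\<forall>x \<in> set xs. 0 < x"
  shows "length xs \<le> sum_list xs"
  using assms by (induction xs) auto

lemma finite_positive_lists:
  "finite {ps :: ('a::finite \<times> nat) list. (\<forall>p \<in> set ps. 0 < snd p) \<and> sum_list (map snd ps) = n}"
proof (rule finite_subset)
  show "{ps :: ('a \<times> nat) list. (\<forall>p \<in> set ps. 0 < snd p) \<and> sum_list (map snd ps) = n}
      \<subseteq> {ps. set ps \<subseteq> UNIV \<times> {..n} \<and> length ps \<le> n}"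
  proof (intro subsetI CollectI conjI; clarsimp)
    fix ps :: "('a \<times> nat) list" and a b
    assume "n = sum_list (map snd ps)" "(a, b) \<in> set ps"
    then show "b \<le> sum_list (map snd ps)"
      by (force intro: member_le_sum_list)
  next
    fix ps :: "('a \<times> nat) list"
    assume "\<forall>p \<in> set ps. 0 < snd p"
    then show "length ps \<le> sum_list (map snd ps)"
      using length_le_sum_list[of "map snd ps"] by simp
  qed
  show "finite {ps :: ('a \<times> nat) list. set ps \<subseteq> UNIV \<times> {..n} \<and> length ps \<le> n}"
    by (rule finite_lists_length_le) simp
qed

instance color :: finite
proof
  have "(UNIV :: color set) \<subseteq> {Red, Green}"
    using color.exhaust by blast
  then show "finite (UNIV :: color set)"
    by (rule finite_subset) simp
qed

lemma finite_two_color_partitions: "finite (two_color_partitions n)"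
proof -
  let ?A = "{ps :: (color \<times> nat) list. (\<forall>p \<in> set ps. 0 < snd p) \<and> sum_list (map snd ps) = n}"
  have "two_color_partitions n \<subseteq> mset ` ?A"
  proof
    fix M assume M: "M \<in> two_color_partitions n"
    obtain xs where xs: "M = mset xs" using ex_mset by metis
    have "xs \<in> ?A"
      using M unfolding xs two_color_partitions_def
      by (simp add: sum_mset_sum_list flip: mset_map)
    then show "M \<in> mset ` ?A" unfolding xs by (rule imageI)
  qed
  then show ?thesis
    using finite_subset[OF _ finite_imageI[OF finite_positive_lists]] by blast
qed

lemma finite_overpartitions: "finite (overpartitions n)"
proof -
  let ?A = "{ps :: (bool \<times> nat) list. (\<forall>p \<in> set ps. 0 < snd p) \<and> sum_list (map snd ps) = n}"
  have "overpartitions n \<subseteq> map prod.swap ` ?A"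
  proof
    fix ps assume "ps \<in> overpartitions n"
    then have "map prod.swap ps \<in> ?A"
      by (auto simp: overpartitions_def is_overpartition_def is_partition_def comp_def)
    moreover have "ps = map prod.swap (map prod.swap ps)" by (simp add: comp_def)
    ultimately show "ps \<in> map prod.swap ` ?A" by (rule rev_image_eqI)
  qed
  then show ?thesis
    using finite_subset[OF _ finite_imageI[OF finite_positive_lists]] by blast
qed

end

theory Submission
  imports Defs "HOL-Computational_Algebra.Formal_Power_Series"
begin

text \<open>
  Let \<open>U n\<close> be the generating function of the admissible overpartitions with at most \<open>n\<close> parts, and
  \<open>V n\<close> the one where condition (i) is dropped. Subtracting 1 from every part of an overpartition
  with exactly \<open>n\<close> parts gives recurrences for \<open>U\<close> and \<open>V\<close>, which say that
  \<open>\<delta> n = (q; q)\<^sub>n U n\<close> and \<open>\<kappa> n = (q; q)\<^sub>n V n\<close> satisfy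
  \<open>\<delta> n = \<delta> (n - 1) + q\<^bsup>2n\<^esup> \<kappa> (n - 1)\<close> and \<open>\<kappa> n = \<kappa> (n - 1) + q\<^bsup>n\<^esup> \<delta> (n - 1)\<close>.
  In the limit, \<open>\<delta>\<close> is the sum of \<open>q\<^bsup>2 m\<^sub>1 + m\<^sub>2 + 2 m\<^sub>3 + m\<^sub>4 + \<dots>\<^esup>\<close> over all
  \<open>m\<^sub>1 > m\<^sub>2 > \<dots> > 0\<close>. Passing to the sums \<open>\<Sum>m. \<delta> m q\<^bsup>sm\<^esup>\<close> turns it into the
  Durfee rectangle expansion \<open>\<Sum>j. a\<^bsup>j\<^esup> Q\<^bsup>j\<^sup>2\<^esup> / ((a; Q)\<^bsub>j+1\<^esub> (Q; Q)\<^sub>j)\<close> of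
  \<open>1 / (a; Q)\<^sub>\<infinity>\<close> for \<open>a = q\<^sup>2\<close> and \<open>Q = q\<^sup>3\<close>, and so
  \<open>U\<close> tends to \<open>1 / ((q; q)\<^sub>\<infinity> (q\<^sup>2; q\<^sup>3)\<^sub>\<infinity>)\<close>. Limits are replaced by congruences
  modulo powers of \<open>q\<close>.
\<close>

section \<open>Recurrences and the Durfee rectangle expansion\<close>

fun delta :: "'a::comm_ring_1 \<Rightarrow> nat \<Rightarrow> 'a" and kappa :: "'a::comm_ring_1 \<Rightarrow> nat \<Rightarrow> 'a" where
  "delta q 0 = 1"
| "kappa q 0 = 1"
| "delta q (Suc n) = delta q n + q ^ (2 * Suc n) * kappa q n"
| "kappa q (Suc n) = kappa q n + q ^ Suc n * delta q n"

text \<open>Summation by parts: multiplying by \<open>1 - q ^ s\<close> produces the differences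
  \<open>delta q m - delta q (m - 1)\<close>, which the recurrence turns into terms of
  \<open>kappa\<close>. The subtracted bracket collects the boundary terms at \<open>M\<close>. For
  \<open>kappa_sum\<close> the roles are exchanged.\<close>

lemma delta_sum:
  "(1 - q ^ s) * (\<Sum>m\<le>M. delta q m * q ^ (s * m)) =
     1 + q ^ (s + 2) * (\<Sum>m\<le>M. kappa q m * q ^ ((s + 2) * m))
     - (delta q M * q ^ (s * Suc M) + kappa q M * q ^ ((s + 2) * Suc M))"
proof (induction M)
  case (Suc M)
  show ?case
    unfolding sum.atMost_Suc distrib_left Suc.IH by (simp add: algebra_simps power_add mult_2_right)
qed (simp add: algebra_simps power_add)

lemma kappa_sum:
  "(1 - q ^ s) * (\<Sum>m\<le>M. kappa q m * q ^ (s * m)) =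
     1 + q ^ (s + 1) * (\<Sum>m\<le>M. delta q m * q ^ ((s + 1) * m))
     - (kappa q M * q ^ (s * Suc M) + delta q M * q ^ ((s + 1) * Suc M))"
proof (induction M)
  case (Suc M)
  show ?case
    unfolding sum.atMost_Suc distrib_left Suc.IH by (simp add: algebra_simps power_add mult_2_right)
qed (simp add: algebra_simps power_add)

section \<open>Congruence modulo a ring element\<close>

definition dvd_cong :: "'a::comm_ring_1 \<Rightarrow> 'a \<Rightarrow> 'a \<Rightarrow> bool" where
  "dvd_cong d x y \<longleftrightarrow> d dvd x - y"

lemma dvd_cong_refl [simp]: "dvd_cong d x x"
  by (simp add: dvd_cong_def)

lemma dvd_cong_trans [trans]: "dvd_cong d x y \<Longrightarrow> dvd_cong d y z \<Longrightarrow> dvd_cong d x z"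
  unfolding dvd_cong_def by (metis dvd_add diff_add_cancel add_diff_eq)

lemma dvd_cong_add: "dvd_cong d x y \<Longrightarrow> dvd_cong d x' y' \<Longrightarrow> dvd_cong d (x + x') (y + y')"
  unfolding dvd_cong_def by (simp add: add_diff_add)

lemma dvd_cong_diff: "dvd_cong d x y \<Longrightarrow> dvd_cong d x' y' \<Longrightarrow> dvd_cong d (x - x') (y - y')"
  unfolding dvd_cong_def by (metis diff_diff_eq2 diff_diff_add add.commute diff_add_eq dvd_diff)

lemma dvd_cong_mult: "dvd_cong d x y \<Longrightarrow> dvd_cong d x' y' \<Longrightarrow> dvd_cong d (x * x') (y * y')"
  unfolding dvd_cong_def by (simp add: mult_diff_mult)

lemma dvd_cong_0I: "d dvd x \<Longrightarrow> dvd_cong d x 0"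
  by (simp add: dvd_cong_def)

lemma dvd_cong_cancel:
  assumes "c dvd 1" "dvd_cong d (x * c) (y * c)"
  shows "dvd_cong d x y"
proof -
  obtain e where "1 = c * e" using assms(1) by (auto elim: dvdE)
  then have "x = x * c * e" "y = y * c * e" by (simp_all add: mult.assoc)
  then show ?thesis using dvd_cong_mult[OF assms(2) dvd_cong_refl[of d e]] by simp
qed

text \<open>The \<open>j\<close>-th value is the numerator of the Durfee rectangle series of \<open>1 / (a; Q)\<^sub>\<infinity>\<close>, truncated
  after the rectangle of width \<open>j\<close>, over the denominator \<open>(a; Q)\<^bsub>j+1\<^esub> (Q; Q)\<^sub>j\<close>.\<close>

primrec durfee :: "'a::comm_ring_1 \<Rightarrow> 'a \<Rightarrow> nat \<Rightarrow> 'a" where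
  "durfee a Q 0 = 1"
| "durfee a Q (Suc j) =
     durfee a Q j * (1 - a * Q ^ Suc j) * (1 - Q ^ Suc j) + a ^ Suc j * Q ^ ((Suc j)\<^sup>2)"

text \<open>Up to a term of high order, this is \<open>(1 - a) f(a) = f(a Q)\<close> for \<open>f(a) = 1 / (a; Q)\<^sub>\<infinity>\<close>.\<close>

lemma durfee_shift:
  "(1 - a * Q ^ Suc j) * durfee a Q j = durfee (a * Q) Q j - a ^ Suc j * Q ^ ((Suc j)\<^sup>2)"
proof (induction j)
  case 0
  show ?case by simp
next
  case (Suc j)
  \<comment> \<open>In terms of \<open>r\<close>, \<open>A\<close>, \<open>t\<close> and
    \<open>durfee a Q j\<close> the claim is a polynomial identity, once the induction hypothesis
    has eliminated \<open>durfee (a * Q) Q j\<close>.\<close>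
  define r where "r = Q ^ Suc j"
  define A where "A = a ^ Suc j"
  define t where "t = Q ^ ((Suc j)\<^sup>2)"
  have pows: "Q ^ Suc (Suc j) = Q * r" "a ^ Suc (Suc j) = a * A"
    "(a * Q) ^ Suc j = A * r" "Q ^ ((Suc (Suc j))\<^sup>2) = t * r * r * Q"
    unfolding r_def A_def t_def
    by (simp_all add: power_mult_distrib power2_eq_square flip: power_add power_Suc power_Suc2)
      (simp add: power_add algebra_simps)
  have IH: "durfee (a * Q) Q j = (1 - a * r) * durfee a Q j + A * t"
    using Suc.IH by (simp add: r_def A_def t_def)
  have D: "durfee a Q (Suc j) = durfee a Q j * (1 - a * r) * (1 - r) + A * t"
    by (simp add: r_def A_def t_def)
  have D': "durfee (a * Q) Q (Suc j) = durfee (a * Q) Q j * (1 - a * Q * r) * (1 - r) + A * r * t"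
    using pows(3) by (simp add: r_def t_def)
  show ?case
    unfolding D D' pows IH by (simp add: algebra_simps)
qed

lemma durfee_0: "durfee 0 Q j = (\<Prod>i=1..j. 1 - Q ^ i)"
  by (induction j) (simp_all add: mult.commute)

lemma durfee_cong_0:
  assumes "d dvd a"
  shows "dvd_cong d (durfee a Q j) (durfee 0 Q j)"
proof (induction j)
  case (Suc j)
  have a: "dvd_cong d a 0"
    using assms by (rule dvd_cong_0I)
  \<comment> \<open>One factor \<open>a\<close> is split off \<open>a ^ Suc j\<close>, so that
    replacing it by 0 removes the added term.\<close>
  have "dvd_cong d (durfee a Q j * (1 - a * Q ^ Suc j) * (1 - Q ^ Suc j) + a * (a ^ j * Q ^ ((Suc j)\<^sup>2)))
     (durfee 0 Q j * (1 - 0 * Q ^ Suc j) * (1 - Q ^ Suc j) + 0 * (a ^ j * Q ^ ((Suc j)\<^sup>2)))"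
    by (intro dvd_cong_add dvd_cong_mult dvd_cong_diff Suc.IH a dvd_cong_refl)
  then show ?case by (simp add: mult.assoc)
qed simp

text \<open>By \<open>durfee_shift\<close>, passing from \<open>a\<close> to \<open>a * Q\<close>
  changes the value only by multiples of \<open>Q ^ Suc j\<close>. After \<open>M\<close> shifts the
  first argument is divisible by \<open>q ^ M\<close> and may be replaced by 0, where the value is a
  plain product.\<close>

lemma durfee_cong:
  assumes "q ^ M dvd Q ^ Suc j" "q ^ M dvd Q ^ M"
  shows "dvd_cong (q ^ M) (durfee a Q j) (\<Prod>i=1..j. 1 - Q ^ i)"
proof -
  have step: "dvd_cong (q ^ M) (durfee a Q j) (durfee (a * Q) Q j)" for a
  proof -
    have Q: "q ^ M dvd Q ^ ((Suc j)\<^sup>2)"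
      using assms(1) by (rule dvd_trans) (rule le_imp_power_dvd, simp add: power2_eq_square)
    have "durfee a Q j - durfee (a * Q) Q j =
       a * Q ^ Suc j * durfee a Q j - a ^ Suc j * Q ^ ((Suc j)\<^sup>2)"
      using durfee_shift[of a Q j] by (simp add: algebra_simps)
    then show ?thesis
      unfolding dvd_cong_def using assms(1) Q by (metis dvd_diff dvd_mult dvd_mult2)
  qed
  have "dvd_cong (q ^ M) (durfee a Q j) (durfee (a * Q ^ k) Q j)" for k
  proof (induction k)
    case (Suc k)
    from Suc.IH step[of "a * Q ^ k"] show ?case
      by (metis dvd_cong_trans mult.assoc power_Suc2)
  qed simp
  also have "dvd_cong (q ^ M) (durfee (a * Q ^ M) Q j) (durfee 0 Q j)"
    using assms(2) by (intro durfee_cong_0) simp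
  finally show ?thesis by (simp add: durfee_0)
qed

text \<open>The two summation formulas are applied in turn, starting from \<open>delta q M\<close>;
  each pair of applications raises the parameter of the sum by 3, costs two factors
  \<open>1 - q ^ i\<close>, and splits off one more Durfee term. The boundary terms vanish modulo
  \<open>q ^ Suc M\<close>.\<close>

lemma delta_durfee:
  "dvd_cong (q ^ Suc M)
     (delta q M * (\<Prod>i\<le>j. 1 - q ^ (2 + 3 * i)) * (\<Prod>i=1..j. 1 - (q ^ 3) ^ i))
     (durfee (q\<^sup>2) (q ^ 3) j + q ^ (2 * Suc j + 3 * (Suc j)\<^sup>2) *
        (\<Sum>m\<le>M. delta q m * q ^ (3 * Suc j * m)))"
proof -
  let ?c = "dvd_cong (q ^ Suc M)"
  let ?d = "\<lambda>s. \<Sum>m\<le>M. delta q m * q ^ (s * m)"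
  let ?k = "\<lambda>s. \<Sum>m\<le>M. kappa q m * q ^ (s * m)"
  have pow: "q ^ Suc M dvd q ^ (s * Suc M)" if "0 < s" for s
    using that mult_le_mono1[of 1 s "Suc M"] by (intro le_imp_power_dvd) simp
  have rem: "?c (x - (y * q ^ (s * Suc M) + z * q ^ (t * Suc M))) x" if "0 < s" "0 < t" for x y z s t
    unfolding dvd_cong_def using pow[OF that(1)] pow[OF that(2)]
    by (simp add: dvd_add)
  have k: "?c ((1 - q ^ s) * ?k s) (1 + q ^ (s + 1) * ?d (s + 1))" if "0 < s" for s
    unfolding kappa_sum using that by (intro rem) simp_all
  have d: "?c ((1 - q ^ s) * ?d s) (1 + q ^ (s + 2) * ?k (s + 2))" if "0 < s" for s
    unfolding delta_sum using that by (intro rem) simp_all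
  have d0: "?c (delta q M) (1 + q ^ 2 * ?k 2)"
  proof -
    \<comment> \<open>This is \<open>delta_sum\<close> at \<open>s = 0\<close>, where the left side
      vanishes; the zero summand only gives the bracket the shape of \<open>rem\<close>.\<close>
    have "delta q M = 1 + q ^ 2 * ?k 2 - (0 * q ^ (1 * Suc M) + kappa q M * q ^ (2 * Suc M))"
      using delta_sum[of q 0 M] by (simp add: algebra_simps power2_eq_square mult_2_right)
    then show ?thesis
      by (metis rem zero_less_one zero_less_numeral)
  qed
  \<comment> \<open>The two occurrences of \<open>q ^ s\<close> cancel after expansion, which leaves
    the constant term 1.\<close>
  have kd: "?c ((1 - q ^ s) * (1 + q ^ s * ?k s)) (1 + q ^ (2 * s + 1) * ?d (s + 1))" if "0 < s" for s
  proof -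
    have "?c ((1 - q ^ s) + q ^ s * ((1 - q ^ s) * ?k s))
        ((1 - q ^ s) + q ^ s * (1 + q ^ (s + 1) * ?d (s + 1)))"
      by (intro dvd_cong_add dvd_cong_mult dvd_cong_refl k that)
    moreover have "(1 - q ^ s) + q ^ s * ((1 - q ^ s) * ?k s) = (1 - q ^ s) * (1 + q ^ s * ?k s)"
      by (simp add: algebra_simps)
    moreover have "(1 - q ^ s) + q ^ s * (1 + q ^ (s + 1) * ?d (s + 1)) = 1 + q ^ (2 * s + 1) * ?d (s + 1)"
      by (simp add: algebra_simps power_add mult_2_right)
    ultimately show ?thesis by (simp only:)
  qed
  show ?thesis
  proof (induction j)
    case 0
    have "?c (delta q M * (1 - q\<^sup>2)) ((1 + q ^ 2 * ?k 2) * (1 - q\<^sup>2))"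
      by (intro dvd_cong_mult d0 dvd_cong_refl)
    also have "?c \<dots> (1 + q ^ 5 * ?d 3)"
      using kd[of 2] by (simp add: mult.commute)
    finally show ?case by simp
  next
    case (Suc j)
    let ?s = "3 * Suc j"
    let ?R = "q ^ (2 * Suc j + 3 * (Suc j)\<^sup>2)"
    \<comment> \<open>These are the next factors of the two products: \<open>?v\<close> turns the
      \<open>delta\<close> sum into a \<open>kappa\<close> sum, then \<open>?u\<close> turns that
      into the next \<open>delta\<close> sum.\<close>
    let ?u = "1 - q ^ (2 + ?s)" and ?v = "1 - q ^ ?s"
    have "?c (delta q M * (\<Prod>i\<le>j. 1 - q ^ (2 + 3 * i)) * (\<Prod>i=1..j. 1 - (q ^ 3) ^ i) * (?u * ?v))
       ((durfee (q\<^sup>2) (q ^ 3) j + ?R * ?d ?s) * (?u * ?v))"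
      by (intro dvd_cong_mult Suc.IH dvd_cong_refl)
    also have "(durfee (q\<^sup>2) (q ^ 3) j + ?R * ?d ?s) * (?u * ?v) =
       durfee (q\<^sup>2) (q ^ 3) j * ?u * ?v + ?R * (?u * (?v * ?d ?s))"
      by (simp only: algebra_simps)
    also have "?c \<dots> (durfee (q\<^sup>2) (q ^ 3) j * ?u * ?v + ?R * (?u * (1 + q ^ (?s + 2) * ?k (?s + 2))))"
      by (intro dvd_cong_add dvd_cong_mult d dvd_cong_refl) simp
    also have "?c \<dots> (durfee (q\<^sup>2) (q ^ 3) j * ?u * ?v + ?R * (1 + q ^ (2 * (?s + 2) + 1) * ?d (?s + 3)))"
      using kd[of "?s + 2"]
      by (intro dvd_cong_add dvd_cong_mult dvd_cong_refl) (simp add: add.commute)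
    also have "\<dots> = durfee (q\<^sup>2) (q ^ 3) (Suc j) +
        q ^ (2 * Suc (Suc j) + 3 * (Suc (Suc j))\<^sup>2) * ?d (3 * Suc (Suc j))"
    proof -
      \<comment> \<open>\<open>?R\<close> has two uses: it is the next Durfee term for
        \<open>a = q ^ 2\<close> and \<open>Q = q ^ 3\<close>, and its product with the power from
        \<open>kd\<close> is the new coefficient of the remaining sum.\<close>
      have "?R * q ^ (2 * (?s + 2) + 1) = q ^ (2 * Suc (Suc j) + 3 * (Suc (Suc j))\<^sup>2)"
        by (simp add: power2_eq_square algebra_simps flip: power_add)
      moreover have "(q\<^sup>2) ^ Suc j * (q ^ 3) ^ ((Suc j)\<^sup>2) = ?R"
        by (simp only: power_add power_mult)
      moreover have "q\<^sup>2 * (q ^ 3) ^ Suc j = q ^ (2 + ?s)" "(q ^ 3) ^ Suc j = q ^ ?s"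
        by (simp_all only: power_add power_mult)
      moreover have "?s + 3 = 3 * Suc (Suc j)" by simp
      ultimately show ?thesis
        by (simp only: durfee.simps distrib_left mult_1_right add.assoc mult.assoc[symmetric])
    qed
    finally have main: "?c (delta q M * (\<Prod>i\<le>j. 1 - q ^ (2 + 3 * i)) * (\<Prod>i=1..j. 1 - (q ^ 3) ^ i) * (?u * ?v))
       (durfee (q\<^sup>2) (q ^ 3) (Suc j) +
        q ^ (2 * Suc (Suc j) + 3 * (Suc (Suc j))\<^sup>2) * ?d (3 * Suc (Suc j)))" .
    have "(\<Prod>i\<le>Suc j. 1 - q ^ (2 + 3 * i)) = (\<Prod>i\<le>j. 1 - q ^ (2 + 3 * i)) * ?u"
      by (simp only: prod.atMost_Suc)
    moreover have "(\<Prod>i=1..Suc j. 1 - (q ^ 3) ^ i) = (\<Prod>i=1..j. 1 - (q ^ 3) ^ i) * ?v"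
      by (simp only: power_mult) (simp add: mult.commute)
    ultimately show ?case
      using main by (simp only: mult_ac)
  qed
qed


text \<open>Taking \<open>j = M\<close> in \<open>delta_durfee\<close> makes the remaining sum
  vanish modulo \<open>q ^ Suc M\<close>, and \<open>durfee_cong\<close> evaluates the Durfee
  numerator as \<open>?C\<close>. The hypothesis makes \<open>?C\<close> a unit, so it
  cancels.\<close>

lemma delta_cong:
  assumes "\<And>i. 0 < i \<Longrightarrow> 1 - q ^ i dvd 1"
  shows "dvd_cong (q ^ Suc M) (delta q M * (\<Prod>i\<le>M. 1 - q ^ (2 + 3 * i))) 1"
proof -
  let ?C = "\<Prod>i=1..M. 1 - (q ^ 3) ^ i"
  let ?r = "q ^ (2 * Suc M + 3 * (Suc M)\<^sup>2) * (\<Sum>m\<le>M. delta q m * q ^ (3 * Suc M * m))"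
  have "q ^ Suc M dvd q ^ (2 * Suc M + 3 * (Suc M)\<^sup>2)"
    by (rule le_imp_power_dvd) simp
  then have r: "dvd_cong (q ^ Suc M) ?r 0"
    by (intro dvd_cong_0I dvd_mult2)
  have pow: "q ^ Suc M dvd (q ^ 3) ^ Suc M"
    by (simp only: power_mult[symmetric]) (rule le_imp_power_dvd, simp)
  note delta_durfee[of q M M]
  also have "dvd_cong (q ^ Suc M) (durfee (q\<^sup>2) (q ^ 3) M + ?r) (?C + 0)"
    using pow by (intro dvd_cong_add r durfee_cong) (simp_all add: dvd_power_le)
  finally have "dvd_cong (q ^ Suc M) (delta q M * (\<Prod>i\<le>M. 1 - q ^ (2 + 3 * i)) * ?C) (1 * ?C)"
    by simp
  moreover have "?C dvd 1"
  proof -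
    have "?C dvd (\<Prod>i=1..M. 1)"
    proof (rule prod_dvd_prod)
      show "1 - (q ^ 3) ^ i dvd 1" if "i \<in> {1..M}" for i
        using that assms[of "3 * i"] by (simp only: power_mult[symmetric]) simp
    qed
    then show ?thesis by simp
  qed
  ultimately show ?thesis using dvd_cong_cancel by blast
qed

section \<open>Overpartitions with a bounded number of parts\<close>

text \<open>One pairwise relation combines the order of the sizes with the rule on overlining, so
  that the laws of \<open>sorted_wrt\<close> for append and map apply to overpartitions.\<close>

definition leads :: "opart \<Rightarrow> opart \<Rightarrow> bool" where
  "leads p r \<longleftrightarrow> fst r \<le> fst p \<and> (snd r \<longrightarrow> fst r \<noteq> fst p)"

lemma is_overpartition_iff:
  "is_overpartition ps n \<longleftrightarrow>
     sorted_wrt leads ps \<and> (\<forall>p \<in> set ps. 0 < fst p) \<and> sum_list (map fst ps) = n"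
  unfolding is_overpartition_def is_partition_def sorted_wrt_iff_nth_less leads_def
  by (auto; metis)

definition weakly_admissible :: "opart list \<Rightarrow> bool" where
  "weakly_admissible ps \<longleftrightarrow>
     (\<forall>k > 0. occurs (k + 1) ps \<and> overlined k \<in> set ps \<longrightarrow> overlined (k + 1) \<in> set ps)"

lemma admissible_iff:
  "admissible ps \<longleftrightarrow> weakly_admissible ps \<and> (occurs 1 ps \<longrightarrow> overlined 1 \<in> set ps)"
  by (auto simp: admissible_def weakly_admissible_def)

text \<open>Inverse of subtracting 1 from every part of an overpartition with \<open>n\<close> parts; the flag \<open>b\<close>
  tells whether the first 1 is overlined.\<close>

definition add_ones :: "nat \<Rightarrow> bool \<Rightarrow> opart list \<Rightarrow> opart list" where
  "add_ones n b ps = map (apfst Suc) ps @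
     (if length ps < n then (1, b) # replicate (n - length ps - 1) (plain 1) else [])"

lemma length_add_ones: "length ps \<le> n \<Longrightarrow> length (add_ones n b ps) = n"
  by (simp add: add_ones_def)

lemma sum_add_ones:
  "length ps \<le> n \<Longrightarrow> sum_list (map fst (add_ones n b ps)) = sum_list (map fst ps) + n"
  by (simp add: add_ones_def comp_def sum_list_Suc sum_list_replicate)

lemma set_add_ones:
  "set (add_ones n b ps) = apfst Suc ` set ps \<union>
     (if length ps < n then {(1, b)} else {}) \<union> (if length ps + 1 < n then {plain 1} else {})"
  by (auto simp: add_ones_def)


lemma overpartition_add_ones:
  assumes "is_overpartition ps N" "length ps \<le> n"
  shows "is_overpartition (add_ones n b ps) (N + n)"
proof -
  have "sorted_wrt leads (replicate k (plain 1))" for k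
    by (induction k) (simp_all add: leads_def)
  moreover have "leads (apfst Suc p) (apfst Suc r) \<longleftrightarrow> leads p r" for p r
    by (simp add: leads_def)
  moreover have "leads (apfst Suc p) (1, c)" if "0 < fst p" for p c
    using that by (simp add: leads_def)
  moreover have "leads (1, c) (plain 1)" for c
    by (simp add: leads_def)
  ultimately show ?thesis
    using assms sum_add_ones[OF assms(2), of b]
    by (auto simp: is_overpartition_iff add_ones_def sorted_wrt_append sorted_wrt_map)
qed

lemma overpartition_cases:
  assumes "is_overpartition rs N"
  obtains ps b where "is_overpartition ps (N - length rs)" "length ps \<le> length rs"
    "rs = add_ones (length rs) b ps" "length rs \<le> N"
proof -
  have "\<exists>ps b. sorted_wrt leads ps \<and> (\<forall>p \<in> set ps. 0 < fst p) \<and> length ps \<le> length rs \<and>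
     rs = add_ones (length rs) b ps"
    if "sorted_wrt leads rs" "\<forall>p \<in> set rs. 0 < fst p"
    using that
  proof (induction rs)
    case Nil
    show ?case by (auto simp: add_ones_def)
  next
    case (Cons r rs)
    show ?case
    proof (cases "fst r = 1")
      case True
      \<comment> \<open>After a first part of size 1 only non-overlined copies of 1 can follow, so
        the flag of \<open>r\<close> is the \<open>b\<close> sought and the preimage is
        empty.\<close>
      have "\<forall>p \<in> set rs. p = plain 1"
        using Cons.prems True by (force simp: leads_def)
      then have "rs = replicate (length rs) (plain 1)"
        by (metis replicate_eqI)
      then have "r # rs = add_ones (length (r # rs)) (snd r) []"
        using True by (simp add: add_ones_def prod_eq_iff)
      then show ?thesis by (intro exI[of _ "[]"] exI[of _ "snd r"] conjI; (assumption | simp))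
    next
      case False
      obtain ps b where ps: "sorted_wrt leads ps" "\<forall>p \<in> set ps. 0 < fst p" "length ps \<le> length rs"
        "rs = add_ones (length rs) b ps"
        using Cons by auto
      let ?p = "(fst r - 1, snd r)"
      have "fst r > 1" using Cons.prems False by (simp add: nat_neq_iff)
      have "apfst Suc ` set ps \<subseteq> set rs"
        by (subst ps(4)) (simp add: add_ones_def)
      then have "leads ?p p" if "p \<in> set ps" for p
        using that Cons.prems(1) \<open>fst r > 1\<close> by (force simp: leads_def)
      then have "sorted_wrt leads (?p # ps)" using ps(1) by simp
      moreover have "r # rs = add_ones (length (r # rs)) b (?p # ps)"
      proof -
        have "add_ones (length (r # rs)) b (?p # ps) = r # add_ones (length rs) b ps"
          using \<open>fst r > 1\<close> by (simp add: add_ones_def prod_eq_iff)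
        with ps(4) show ?thesis by metis
      qed
      moreover have "\<forall>p \<in> set (?p # ps). 0 < fst p" "length (?p # ps) \<le> length (r # rs)"
        using ps(2,3) \<open>fst r > 1\<close> by simp_all
      ultimately show ?thesis by blast
    qed
  qed
  then obtain ps b where *: "sorted_wrt leads ps" "\<forall>p \<in> set ps. 0 < fst p" "length ps \<le> length rs"
    "rs = add_ones (length rs) b ps"
    using assms by (auto simp: is_overpartition_iff)
  have "sum_list (map fst ps) + length rs = N"
    using assms sum_add_ones[OF *(3), of b] *(4) by (simp add: is_overpartition_iff)
  with * show ?thesis
    by (intro that[of ps b]) (auto simp: is_overpartition_iff)
qed

text \<open>Adding 1 to every part moves condition (ii) for \<open>k\<close> to
  \<open>k + 1\<close>. At \<open>k = 1\<close> the new list satisfies (ii) exactly if no overlined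
  1 was appended or \<open>ps\<close> satisfies (i). Hence an overlined 1 demands full admissibility
  of \<open>ps\<close>.\<close>

lemma
  assumes "\<forall>p \<in> set ps. 0 < fst p" "length ps \<le> n"
  shows weakly_admissible_add_ones:
      "weakly_admissible (add_ones n b ps) \<longleftrightarrow>
         (if length ps < n \<and> b then admissible ps else weakly_admissible ps)"
    and admissible_add_ones:
      "admissible (add_ones n b ps) \<longleftrightarrow>
         (if length ps = n then weakly_admissible ps else b \<and> admissible ps)"
    and overlined_1_add_ones: "overlined 1 \<in> set (add_ones n b ps) \<longleftrightarrow> length ps < n \<and> b"
proof -
  have ge2: "(Suc k, o') \<in> set (add_ones n c ps) \<longleftrightarrow> (k, o') \<in> set ps" if "0 < k" for k o' c
    using that by (force simp: set_add_ones)
  have one: "(Suc 0, o') \<in> set (add_ones n c ps) \<longleftrightarrow> length ps < n \<and> o' = c \<or> length ps + 1 < n \<and> \<not> o'" for o' c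
    using assms(1) by (force simp: set_add_ones)
  have weak: "weakly_admissible qs \<longleftrightarrow>
      (occurs 2 qs \<and> overlined 1 \<in> set qs \<longrightarrow> overlined 2 \<in> set qs) \<and>
      (\<forall>k > 0. occurs (Suc (Suc k)) qs \<and> overlined (Suc k) \<in> set qs \<longrightarrow> overlined (Suc (Suc k)) \<in> set qs)" for qs
  proof -
    have "(\<forall>k > 0. P k) \<longleftrightarrow> P 1 \<and> (\<forall>k > 0. P (Suc k))" for P
      by (metis One_nat_def gr0_conv_Suc neq0_conv)
    from this[of "\<lambda>k. occurs (k + 1) qs \<and> overlined k \<in> set qs \<longrightarrow> overlined (k + 1) \<in> set qs"]
    show ?thesis by (simp add: weakly_admissible_def numeral_2_eq_2)
  qed
  show w: "weakly_admissible (add_ones n b ps) \<longleftrightarrow>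
         (if length ps < n \<and> b then admissible ps else weakly_admissible ps)"
    unfolding weak[of "add_ones n b ps"]
    by (auto simp: numeral_2_eq_2 occurs_def ge2 one admissible_iff weakly_admissible_def)
  show "overlined 1 \<in> set (add_ones n b ps) \<longleftrightarrow> length ps < n \<and> b"
    using one[of True b] by auto
  show "admissible (add_ones n b ps) \<longleftrightarrow>
         (if length ps = n then weakly_admissible ps else b \<and> admissible ps)"
    unfolding admissible_iff[of "add_ones n b ps"] w using assms(2) by (auto simp: occurs_def one)
qed

lemma inj_on_add_ones: "inj_on (add_ones n b) {ps. (\<forall>p \<in> set ps. 0 < fst p)}"
proof (rule inj_onI)
  fix ps qs :: "opart list"
  assume "ps \<in> {ps. (\<forall>p \<in> set ps. 0 < fst p)}" "qs \<in> {ps. (\<forall>p \<in> set ps. 0 < fst p)}"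
    and eq: "add_ones n b ps = add_ones n b qs"
  \<comment> \<open>Positive parts become at least 2, so deleting the 1s recovers
    \<open>ps\<close>.\<close>
  then have "filter (\<lambda>p. fst p \<noteq> 1) (add_ones n b rs) = map (apfst Suc) rs" if "rs \<in> {ps, qs}" for rs
    using that by (auto simp: add_ones_def filter_map comp_def intro!: filter_True)
  then have "map (apfst Suc) ps = map (apfst Suc) qs"
    using eq by (metis insertCI)
  moreover have "inj (apfst Suc :: opart \<Rightarrow> opart)"
    by (auto simp: inj_def)
  ultimately show "ps = qs" by (simp add: inj_map_eq_map)
qed

section \<open>Recurrences for the numbers of overpartitions with a bounded number of parts\<close>

definition weak_upto :: "nat \<Rightarrow> nat \<Rightarrow> opart list set" where
  "weak_upto n N = {ps. is_overpartition ps N \<and> weakly_admissible ps \<and> length ps \<le> n}"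

definition adm_upto :: "nat \<Rightarrow> nat \<Rightarrow> opart list set" where
  "adm_upto n N = {ps. is_overpartition ps N \<and> admissible ps \<and> length ps \<le> n}"

lemma finite_upto [simp]: "finite (weak_upto n N)" "finite (adm_upto n N)"
  by (rule finite_subset[OF _ finite_overpartitions[of N]],
      auto simp: weak_upto_def adm_upto_def overpartitions_def)+

lemma weak_upto_mono: "m \<le> n \<Longrightarrow> weak_upto m N \<subseteq> weak_upto n N"
  by (auto simp: weak_upto_def)

lemma card_add_ones:
  assumes "A \<subseteq> weak_upto k N"
  shows "card (add_ones n b ` A) = card A"
  using assms
  by (intro card_image inj_on_subset[OF inj_on_add_ones])
    (auto simp: weak_upto_def is_overpartition_iff)

lemma upto_Suc_eq:
  assumes "N < Suc m"
  shows "weak_upto (Suc m) N = weak_upto m N" "adm_upto (Suc m) N = adm_upto m N"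
proof -
  have "length ps \<le> N" if "is_overpartition ps N" for ps
    using that length_le_sum_list[of "map fst ps"] by (simp add: is_overpartition_iff)
  with assms show "weak_upto (Suc m) N = weak_upto m N" "adm_upto (Suc m) N = adm_upto m N"
    by (force simp: weak_upto_def adm_upto_def)+
qed

text \<open>The lists with exactly \<open>Suc m\<close> parts are split by whether an overlined 1
  occurs. If it does, the preimage is admissible and has at most \<open>m\<close> parts.\<close>

lemma weak_upto_Suc:
  "weak_upto (Suc m) (N + Suc m) = weak_upto m (N + Suc m) \<union>
     (add_ones (Suc m) False ` weak_upto (Suc m) N \<union> add_ones (Suc m) True ` adm_upto m N)"
  (is "?L = ?R")
proof (intro equalityI subsetI)
  fix rs assume rs: "rs \<in> ?L"
  show "rs \<in> ?R"
  proof (cases "length rs = Suc m")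
    case True
    obtain ps b where ps: "is_overpartition ps N" "length ps \<le> Suc m" "rs = add_ones (Suc m) b ps"
    proof -
      have "is_overpartition rs (N + Suc m)" using rs by (simp add: weak_upto_def)
      from overpartition_cases[OF this] show thesis
        using that True by (metis add_diff_cancel_right')
    qed
    then have pos: "\<forall>p \<in> set ps. 0 < fst p" by (simp add: is_overpartition_iff)
    have w: "weakly_admissible (add_ones (Suc m) b ps)" using rs ps(3) by (simp add: weak_upto_def)
    show ?thesis
    proof (cases "length ps < Suc m \<and> b")
      case True
      then show ?thesis
        using w ps weakly_admissible_add_ones[OF pos ps(2), of b] by (auto simp: adm_upto_def)
    next
      case False
      \<comment> \<open>If \<open>ps\<close> already has \<open>Suc m\<close> parts, no 1 is
        appended and both flags give the same list; choosing \<open>False\<close> avoids counting it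
        twice.\<close>
      then have "rs = add_ones (Suc m) False ps" using ps(3) by (auto simp: add_ones_def)
      then show ?thesis
        using False w ps weakly_admissible_add_ones[OF pos ps(2), of b] by (auto simp: weak_upto_def)
    qed
  qed (use rs in \<open>auto simp: weak_upto_def\<close>)
next
  fix rs assume "rs \<in> ?R"
  then consider "rs \<in> weak_upto m (N + Suc m)"
    | ps where "ps \<in> weak_upto (Suc m) N" "rs = add_ones (Suc m) False ps"
    | ps where "ps \<in> adm_upto m N" "rs = add_ones (Suc m) True ps"
    by blast
  then show "rs \<in> ?L"
  proof cases
    case 1
    then show ?thesis using weak_upto_mono[of m "Suc m"] by auto
  next
    case 2
    then show ?thesis
      using weakly_admissible_add_ones[of ps "Suc m" False] overpartition_add_ones[of ps N "Suc m" False]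
      by (auto simp: weak_upto_def is_overpartition_iff length_add_ones)
  next
    case 3
    then show ?thesis
      using weakly_admissible_add_ones[of ps "Suc m" True] overpartition_add_ones[of ps N "Suc m" True]
      by (auto simp: weak_upto_def adm_upto_def is_overpartition_iff length_add_ones)
  qed
qed

lemma adm_upto_subset_weak: "adm_upto n N \<subseteq> weak_upto n N"
  by (auto simp: weak_upto_def adm_upto_def admissible_iff)

text \<open>With flag \<open>False\<close>, condition (i) forbids any 1, so the preimage must have
  exactly \<open>Suc m\<close> parts; this is why a set difference appears.\<close>

lemma adm_upto_Suc:
  "adm_upto (Suc m) (N + Suc m) = adm_upto m (N + Suc m) \<union>
     (add_ones (Suc m) False ` (weak_upto (Suc m) N - weak_upto m N) \<union>
      add_ones (Suc m) True ` adm_upto m N)"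
proof -
  have pos: "\<forall>p \<in> set ps. 0 < fst p" if "ps \<in> weak_upto n N" for ps n
    using that by (simp add: weak_upto_def is_overpartition_iff)
  have adm: "adm_upto n N' = {ps \<in> weak_upto n N'. admissible ps}" for n N'
    by (auto simp: weak_upto_def adm_upto_def admissible_iff)
  have F: "admissible (add_ones (Suc m) False ps) \<longleftrightarrow> ps \<notin> weak_upto m N" if "ps \<in> weak_upto (Suc m) N" for ps
    using that admissible_add_ones[OF pos[OF that], of "Suc m" False]
    by (auto simp: weak_upto_def)
  have T: "admissible (add_ones (Suc m) True ps)" if "ps \<in> adm_upto m N" for ps
    using that admissible_add_ones[of ps "Suc m" True]
    by (auto simp: adm_upto_def is_overpartition_iff)
  show ?thesis
    unfolding adm[of "Suc m"] adm[of m "N + Suc m"] weak_upto_Suc using F T by blast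
qed

lemma disjoint_add_ones:
  assumes "A \<subseteq> weak_upto (Suc m) N" "B \<subseteq> weak_upto m N"
  shows "add_ones (Suc m) False ` A \<inter> add_ones (Suc m) True ` B = {}"
    and "weak_upto m N' \<inter> (add_ones (Suc m) False ` A \<union> add_ones (Suc m) True ` B) = {}"
proof -
  have "overlined 1 \<notin> set (add_ones (Suc m) False ps)" if "ps \<in> A" for ps
    using that assms(1) overlined_1_add_ones[of ps "Suc m" False]
    by (auto simp: weak_upto_def is_overpartition_iff)
  moreover have "overlined 1 \<in> set (add_ones (Suc m) True ps)" if "ps \<in> B" for ps
    using that assms(2) overlined_1_add_ones[of ps "Suc m" True]
    by (force simp: weak_upto_def is_overpartition_iff)
  ultimately show "add_ones (Suc m) False ` A \<inter> add_ones (Suc m) True ` B = {}"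
    by (smt (verit) disjoint_iff image_iff)
  have "length (add_ones (Suc m) b ps) = Suc m" if "ps \<in> A \<union> B" for b ps
    using that assms by (intro length_add_ones) (auto simp: weak_upto_def)
  then show "weak_upto m N' \<inter> (add_ones (Suc m) False ` A \<union> add_ones (Suc m) True ` B) = {}"
    by (auto simp: weak_upto_def)
qed

lemma card_weak_upto_Suc:
  "card (weak_upto (Suc m) (N + Suc m)) =
     card (weak_upto m (N + Suc m)) + card (weak_upto (Suc m) N) + card (adm_upto m N)"
proof -
  note D = disjoint_add_ones[OF subset_refl adm_upto_subset_weak]
  show ?thesis
    unfolding weak_upto_Suc[of m N]
    by (simp add: D card_Un_disjoint card_add_ones[OF subset_refl]
        card_add_ones[OF adm_upto_subset_weak] del: add_Suc_right)
qed

text \<open>The cardinality of the set difference is moved to the left side to avoid subtraction of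
  natural numbers.\<close>

lemma card_adm_upto_Suc:
  "card (adm_upto (Suc m) (N + Suc m)) + card (weak_upto m N) =
     card (adm_upto m (N + Suc m)) + card (weak_upto (Suc m) N) + card (adm_upto m N)"
proof -
  let ?W = "weak_upto (Suc m) N - weak_upto m N"
  have W: "card ?W + card (weak_upto m N) = card (weak_upto (Suc m) N)"
    using weak_upto_mono[of m "Suc m" N] by (simp add: card_Diff_subset card_mono)
  note D = disjoint_add_ones[OF Diff_subset adm_upto_subset_weak]
  have D': "adm_upto m (N + Suc m) \<inter>
      (add_ones (Suc m) False ` ?W \<union> add_ones (Suc m) True ` adm_upto m N) = {}"
  proof -
    have "weak_upto m (N + Suc m) \<inter>
        (add_ones (Suc m) False ` ?W \<union> add_ones (Suc m) True ` adm_upto m N) = {}"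
      by (rule D)
    then show ?thesis using adm_upto_subset_weak by blast
  qed
  have "card (adm_upto (Suc m) (N + Suc m)) = card (adm_upto m (N + Suc m)) + (card ?W + card (adm_upto m N))"
    unfolding adm_upto_Suc[of m N]
    by (simp add: D D' card_Un_disjoint card_add_ones[OF Diff_subset]
        card_add_ones[OF adm_upto_subset_weak] del: add_Suc_right)
  with W show ?thesis by simp
qed

lemma upto_0: "weak_upto 0 N = (if N = 0 then {[]} else {})" "adm_upto 0 N = (if N = 0 then {[]} else {})"
  by (auto simp: weak_upto_def adm_upto_def is_overpartition_iff weakly_admissible_def admissible_def occurs_def)

section \<open>Generating functions and their link to \<open>kappa\<close> and
  \<open>delta\<close>\<close>

definition weak_fps :: "nat \<Rightarrow> rat fps" where
  "weak_fps n = Abs_fps (\<lambda>N. of_nat (card (weak_upto n N)))"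

definition adm_fps :: "nat \<Rightarrow> rat fps" where
  "adm_fps n = Abs_fps (\<lambda>N. of_nat (card (adm_upto n N)))"

lemma fps_0: "weak_fps 0 = 1" "adm_fps 0 = 1"
  by (auto simp: fps_eq_iff weak_fps_def adm_fps_def upto_0)

lemma weak_fps_Suc: "weak_fps (Suc m) = weak_fps m + fps_X ^ Suc m * (weak_fps (Suc m) + adm_fps m)"
proof (rule fps_ext)
  fix N
  show "fps_nth (weak_fps (Suc m)) N = fps_nth (weak_fps m + fps_X ^ Suc m * (weak_fps (Suc m) + adm_fps m)) N"
  proof (cases "N < Suc m")
    case False
    then show ?thesis
      using card_weak_upto_Suc[of m "N - Suc m"]
      by (simp add: weak_fps_def adm_fps_def fps_X_power_mult_nth del: power_Suc)
  qed (simp add: weak_fps_def fps_X_power_mult_nth upto_Suc_eq del: power_Suc)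
qed

lemma adm_fps_Suc:
  "adm_fps (Suc m) = adm_fps m + fps_X ^ Suc m * (weak_fps (Suc m) - weak_fps m + adm_fps m)"
proof (rule fps_ext)
  fix N
  show "fps_nth (adm_fps (Suc m)) N =
    fps_nth (adm_fps m + fps_X ^ Suc m * (weak_fps (Suc m) - weak_fps m + adm_fps m)) N"
  proof (cases "N < Suc m")
    case False
    then have "of_nat (card (adm_upto (Suc m) N) + card (weak_upto m (N - Suc m))) =
      (of_nat (card (adm_upto m N) + card (weak_upto (Suc m) (N - Suc m)) + card (adm_upto m (N - Suc m))) :: rat)"
      using card_adm_upto_Suc[of m "N - Suc m"] by simp
    with False show ?thesis
      by (simp add: weak_fps_def adm_fps_def fps_X_power_mult_nth algebra_simps del: power_Suc)
  qed (simp add: adm_fps_def fps_X_power_mult_nth upto_Suc_eq del: power_Suc)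
qed

lemma kappa_delta_fps:
  "kappa fps_X n = (\<Prod>i=1..n. 1 - fps_X ^ i) * weak_fps n \<and>
   delta fps_X n = (\<Prod>i=1..n. 1 - fps_X ^ i) * adm_fps n"
proof (induction n)
  case 0
  show ?case by (simp add: fps_0)
next
  case (Suc n)
  define x :: "rat fps" where "x = fps_X ^ Suc n"
  define E :: "rat fps" where "E = (\<Prod>i=1..n. 1 - fps_X ^ i)"
  have E: "(\<Prod>i=1..Suc n. 1 - fps_X ^ i) = E * (1 - x)"
    by (simp add: E_def x_def mult.commute)
  have x2: "fps_X ^ (2 * Suc n) = x * x"
    by (simp only: x_def mult_2 power_add)
  have W: "(1 - x) * weak_fps (Suc n) = weak_fps n + x * adm_fps n"
    using weak_fps_Suc[of n] by (simp only: flip: x_def) (simp add: algebra_simps)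
  \<comment> \<open>Multiplying by \<open>1 - x\<close> allows \<open>W\<close> to eliminate
    \<open>weak_fps (Suc n)\<close>; the terms linear in \<open>x\<close> then cancel.\<close>
  have U: "(1 - x) * adm_fps (Suc n) = adm_fps n + x * x * weak_fps n"
  proof -
    have "(1 - x) * adm_fps (Suc n) =
        (1 - x) * adm_fps n + x * ((1 - x) * weak_fps (Suc n) - (1 - x) * weak_fps n + (1 - x) * adm_fps n)"
      using adm_fps_Suc[of n] by (simp only: flip: x_def) (simp add: algebra_simps)
    then show ?thesis unfolding W by (simp add: algebra_simps)
  qed
  have "kappa fps_X (Suc n) = E * ((1 - x) * weak_fps (Suc n))"
    using Suc.IH unfolding W kappa.simps by (simp only: E_def[symmetric] x_def[symmetric]) (simp add: algebra_simps)
  moreover have "delta fps_X (Suc n) = E * ((1 - x) * adm_fps (Suc n))"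
    using Suc.IH unfolding U delta.simps x2 by (simp only: E_def[symmetric]) (simp add: algebra_simps)
  ultimately show ?case unfolding E by (simp only: mult.assoc)
qed

section \<open>Multisets of given weight\<close>

definition msets_of_weight :: "('a \<Rightarrow> nat) \<Rightarrow> 'a set \<Rightarrow> nat \<Rightarrow> 'a multiset set" where
  "msets_of_weight w S N = {M. set_mset M \<subseteq> S \<and> (\<Sum>x\<in>#M. w x) = N}"

text \<open>A multiset either avoids \<open>x\<close> or arises by adding one copy of
  \<open>x\<close> to a multiset that may still contain it.\<close>

lemma msets_of_weight_insert:
  assumes "x \<notin> S"
  shows "msets_of_weight w (insert x S) N = msets_of_weight w S N \<union>
      (if w x \<le> N then add_mset x ` msets_of_weight w (insert x S) (N - w x) else {})" (is "?L = ?R")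
    and "msets_of_weight w S N \<inter> add_mset x ` B = {}"
proof -
  show "?L = ?R"
  proof (intro equalityI subsetI)
    fix M assume M: "M \<in> ?L"
    show "M \<in> ?R"
    proof (cases "x \<in># M")
      case True
      then obtain M' where "M = add_mset x M'" by (metis insert_DiffM)
      with M show ?thesis by (auto simp: msets_of_weight_def)
    qed (use M in \<open>auto simp: msets_of_weight_def\<close>)
  qed (auto simp: msets_of_weight_def split: if_splits)
  show "msets_of_weight w S N \<inter> add_mset x ` B = {}"
    using assms by (auto simp: msets_of_weight_def)
qed

lemma finite_msets_of_weight:
  assumes "finite S" "\<forall>x \<in> S. 0 < w x"
  shows "finite (msets_of_weight w S N)"
  using assms
proof (induction S arbitrary: N rule: finite_induct)
  case empty
  show ?case by (rule finite_subset[of _ "{{#}}"]) (auto simp: msets_of_weight_def)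
next
  case (insert x S)
  show ?case
  \<comment> \<open>Removing a copy of \<open>x\<close> keeps the set \<open>insert x S\<close> but
    lowers the weight, hence the inner induction on \<open>N\<close>.\<close>
  proof (induction N rule: less_induct)
    case (less N)
    have "finite (msets_of_weight w (insert x S) (N - w x))" if "w x \<le> N"
      using that insert.prems by (intro less) auto
    with insert show ?case by (subst msets_of_weight_insert(1)) auto
  qed
qed

lemma fps_msets_of_weight:
  assumes "finite S" "\<forall>x \<in> S. 0 < w x"
  shows "Abs_fps (\<lambda>N. of_nat (card (msets_of_weight w S N))) * (\<Prod>x\<in>S. 1 - fps_X ^ w x) =
    (1 :: 'a::comm_ring_1 fps)"
  using assms
proof (induction S rule: finite_induct)
  case empty
  have "msets_of_weight w {} N = (if N = 0 then {{#}} else {})" for N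
    by (auto simp: msets_of_weight_def)
  then show ?case by (auto simp: fps_eq_iff)
next
  case (insert x S)
  define G :: "'b set \<Rightarrow> 'a fps"
    where "G S = Abs_fps (\<lambda>N. of_nat (card (msets_of_weight w S N)))" for S
  have fin: "finite (msets_of_weight w S N)" "finite (msets_of_weight w (insert x S) N)" for N
    using insert by (auto intro!: finite_msets_of_weight)
  have "G (insert x S) = G S + fps_X ^ w x * G (insert x S)"
  proof (rule fps_ext)
    fix N
    have "card (msets_of_weight w (insert x S) N) = card (msets_of_weight w S N) +
       (if w x \<le> N then card (msets_of_weight w (insert x S) (N - w x)) else 0)"
      using insert.hyps
      by (subst msets_of_weight_insert(1))
        (auto simp: card_Un_disjoint fin msets_of_weight_insert(2) card_image inj_on_def)
    then show "fps_nth (G (insert x S)) N = fps_nth (G S + fps_X ^ w x * G (insert x S)) N"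
      by (simp add: G_def fps_X_power_mult_nth)
  qed
  then have "G (insert x S) * (1 - fps_X ^ w x) = G S"
    by (simp add: algebra_simps)
  then show ?case
    using insert by (simp add: mult.assoc[symmetric] flip: G_def)
qed

section \<open>Comparison of the coefficients of order \<open>n\<close>\<close>

theorem theorem1p5:
  fixes n :: nat
  shows "card {ps \<in> overpartitions n. admissible ps} =
         card {M \<in> two_color_partitions n. \<forall>k. (Green, k) \<in># M \<longrightarrow> k mod 3 = 2}"
proof -
  \<comment> \<open>A finite set of coloured parts that contains all those usable in a partition of
    \<open>n\<close>; its ranges are chosen so that its product is exactly \<open>E * P\<close>,
    with \<open>P\<close> as in \<open>delta_cong\<close>.\<close>
  define S where "S = Pair Red ` {1..n} \<union> (\<lambda>i. (Green, 2 + 3 * i)) ` {..n}"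
  define G :: "rat fps" where "G = Abs_fps (\<lambda>N. of_nat (card (msets_of_weight snd S N)))"
  define E :: "rat fps" where "E = (\<Prod>i=1..n. 1 - fps_X ^ i)"
  define P :: "rat fps" where "P = (\<Prod>i\<le>n. 1 - fps_X ^ (2 + 3 * i))"
  have "(\<Prod>x\<in>S. 1 - fps_X ^ snd x :: rat fps) = E * P"
    unfolding S_def E_def P_def
    by (subst prod.union_disjoint) (auto simp: prod.reindex inj_on_def)
  moreover have "finite S" "\<forall>x \<in> S. 0 < snd x"
    by (auto simp: S_def)
  ultimately have GEP: "G * (E * P) = 1"
    using fps_msets_of_weight[of S snd, where 'a = rat] by (simp add: G_def)
  have "dvd_cong (fps_X ^ Suc n) (delta fps_X n * P) 1"
    unfolding P_def by (rule delta_cong) simp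
  also have "delta fps_X n * P = adm_fps n * (E * P)"
    using kappa_delta_fps[of n] by (simp add: E_def mult_ac)
  finally have "dvd_cong (fps_X ^ Suc n) (adm_fps n * (E * P)) (G * (E * P))"
    unfolding GEP .
  moreover have "E * P dvd 1"
    using GEP by (metis dvd_triv_right)
  ultimately have "fps_X ^ Suc n dvd adm_fps n - G"
    using dvd_cong_cancel unfolding dvd_cong_def by blast
  then obtain k where "adm_fps n - G = fps_X ^ Suc n * k"
    by (elim dvdE)
  \<comment> \<open>Congruence modulo \<open>fps_X ^ Suc n\<close> still determines the coefficient
    of order \<open>n\<close>, and an overpartition of \<open>n\<close> has at most \<open>n\<close>
    parts.\<close>
  then have "fps_nth (adm_fps n - G) n = 0"
    by (simp only: fps_X_power_mult_nth) simp
  then have "card (adm_upto n n) = card (msets_of_weight snd S n)"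
    by (simp add: adm_fps_def G_def)
  moreover have "adm_upto n n = {ps \<in> overpartitions n. admissible ps}"
  proof -
    have "length ps \<le> n" if "is_overpartition ps n" for ps
      using that length_le_sum_list[of "map fst ps"] by (simp add: is_overpartition_iff)
    then show ?thesis by (auto simp: adm_upto_def overpartitions_def)
  qed
  moreover have "msets_of_weight snd S n =
      {M \<in> two_color_partitions n. \<forall>k. (Green, k) \<in># M \<longrightarrow> k mod 3 = 2}" (is "?L = ?R")
  proof (intro equalityI subsetI)
    have "0 < k" "c = Green \<longrightarrow> k mod 3 = 2" if "(c, k) \<in> S" for c k
      using that by (auto simp: S_def; presburger)+
    moreover fix M assume "M \<in> ?L"
    ultimately show "M \<in> ?R"
      by (fastforce simp: msets_of_weight_def two_color_partitions_def)
  next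
    fix M assume M: "M \<in> ?R"
    have "(c, k) \<in> S" if ck: "(c, k) \<in># M" for c k
    proof -
      \<comment> \<open>Splitting off the part shows \<open>k <= n\<close>, which places it in the
        truncated set \<open>S\<close>.\<close>
      obtain M' where "M = add_mset (c, k) M'" using ck by (metis insert_DiffM)
      with M have k: "0 < k" "k \<le> n" "c = Green \<longrightarrow> k mod 3 = 2"
        by (auto simp: two_color_partitions_def)
      show ?thesis
      proof (cases c)
        case Green
        then have "k = 2 + 3 * (k div 3)" "k div 3 \<le> n" using k by presburger+
        then show ?thesis using Green by (auto simp: S_def)
      qed (use k in \<open>auto simp: S_def\<close>)
    qed
    with M show "M \<in> ?L" by (auto simp: msets_of_weight_def two_color_partitions_def)
  qed
  ultimately show ?thesis by simp
qed

end
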